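(* Breaker (the second player) has a winning strategy in the Maker-Breaker game played on a transversal design $\mathrm{TD}(4,4)$.
   Context: A transversal design $\mathrm{TD}(k,n)$ is a triple $(X,\mathcal{G},\mathcal{B})$ where $X$ is a set of $kn$ points, $\mathcal{G}$ is a partition of $X$ into $k$ subsets of cardinality $n$ (the groups), and $\mathcal{B}$ is a set of $k$-element subsets of $X$ (the blocks) such that every pair of points not in the same group appears in exactly one block, and no block contains two points of the same group. The Maker-Breaker game on a design: Maker and Breaker alternately choose points not chosen before, Maker moving first. Maker wins if he at some time has chosen all points of some block; Breaker wins if all points have been chosen and Maker has not completed a block. Only the blocks (not the groups) are winning sets. A player "can win" if they have a winning strategy. *)

theory Defs
  imports Main "HOL-Library.Disjoint_Sets"
begin

locale transversal_design =
  fixes k n :: nat and X :: "'a set" and \<G> \<B> :: "'a set set"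
  assumes finite_points: "finite X"
    and card_points: "card X = k * n"
    and groups_partition: "partition_on X \<G>"
    and card_groups: "card \<G> = k"
    and card_group: "\<And>G. G \<in> \<G> \<Longrightarrow> card G = n"
    and block_subset: "\<And>B. B \<in> \<B> \<Longrightarrow> B \<subseteq> X"
    and card_block: "\<And>B. B \<in> \<B> \<Longrightarrow> card B = k"
    and unique_block: "\<And>x y. \<lbrakk>x \<in> X; y \<in> X; \<not> (\<exists>G\<in>\<G>. x \<in> G \<and> y \<in> G)\<rbrakk>
          \<Longrightarrow> \<exists>!B. B \<in> \<B> \<and> x \<in> B \<and> y \<in> B"
    and block_transversal: "\<And>B G x y. \<lbrakk>B \<in> \<B>; G \<in> \<G>; x \<in> B; y \<in> B; x \<in> G; y \<in> G\<rbrakk> \<Longrightarrow> x = y"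

text \<open>A (partial) play is the list of the points chosen so far, in chronological order; Maker moves
  first, so Maker's moves are those at even positions (counting from 0). Play formally
  continues until all points are chosen, even if Maker has already completed a winning set.\<close>

definition is_play :: "'a set \<Rightarrow> 'a list \<Rightarrow> bool" where
  "is_play X p \<longleftrightarrow> distinct p \<and> set p \<subseteq> X"

definition maker_points :: "'a list \<Rightarrow> 'a set" where
  "maker_points p = {p ! i | i. i < length p \<and> even i}"

definition maker_wins_play :: "'a set set \<Rightarrow> 'a list \<Rightarrow> bool" where
  "maker_wins_play W p \<longleftrightarrow> (\<exists>t \<le> length p. \<exists>B\<in>W. B \<subseteq> maker_points (take t p))"

definition breaker_wins_play :: "'a set \<Rightarrow> 'a set set \<Rightarrow> 'a list \<Rightarrow> bool" where
  "breaker_wins_play X W p \<longleftrightarrow> set p = X \<and> \<not> maker_wins_play W p"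

text \<open>A strategy for Breaker maps the history of the game to Breaker's next move; only its values on
  histories of odd length, where it is Breaker's turn, matter.\<close>

definition follows_breaker :: "('a list \<Rightarrow> 'a) \<Rightarrow> 'a list \<Rightarrow> bool" where
  "follows_breaker \<sigma> p \<longleftrightarrow> (\<forall>i < length p. odd i \<longrightarrow> p ! i = \<sigma> (take i p))"

text \<open>The first conjunct (only legal moves are prescribed) excludes strategies that win vacuously
  because no complete play follows them. Meaningful for finite \<open>X\<close>.\<close>

definition breaker_winning_strategy :: "'a set \<Rightarrow> 'a set set \<Rightarrow> ('a list \<Rightarrow> 'a) \<Rightarrow> bool" where
  "breaker_winning_strategy X W \<sigma> \<longleftrightarrow>
     (\<forall>p. is_play X p \<and> follows_breaker \<sigma> p \<longrightarrow>
        (odd (length p) \<and> set p \<noteq> X \<longrightarrow> \<sigma> p \<in> X - set p) \<and>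
        (set p = X \<longrightarrow> breaker_wins_play X W p))"

definition breaker_can_win :: "'a set \<Rightarrow> 'a set set \<Rightarrow> bool" where
  "breaker_can_win X W \<longleftrightarrow> (\<exists>\<sigma>. breaker_winning_strategy X W \<sigma>)"

end

theory Submission imports Complex_Main Defs begin

text \<open>Labelling the groups suitably, with Maker's first point labelled 0, turns the design into a pair of
  orthogonal Latin squares of order 4 in reduced form. Only two such pairs exist, and the Frobenius
  automorphism of the field with four elements exchanges them, so one concrete design with Maker's
  first point fixed remains. There Breaker always claims a point of maximal total weight, a block
  that misses \<open>m\<close> points to Maker weighing \<open>2 ^ (- m)\<close>. A search over Maker's moves
  ends on every branch in a position of total weight less than 1 with Breaker to move, which
  Breaker wins by the Erdos-Selfridge criterion.\<close>

text \<open>The criterion does not apply right away: after Maker's first point four blocks weigh 1/8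
  and twelve weigh 1/16, in total 5/4. Hence the search, and hence the need for an explicit design.
  Since Breaker's replies follow a fixed rule, only Maker's moves branch; 15 points remain after the
  opening and seven pairs of moves leave one, which gives the depth 7.

  One group names the rows, another the columns, and the blocks then write one square in each of the
  other two groups. The labels are used to normalise the first rows of both squares and the first
  column of one. The first column of the other is no longer free, and there the two solutions
  differ.\<close>

subsection \<open>Positions and strategies\<close>

text \<open>In a position where Maker owns \<open>M\<close> and Breaker owns \<open>N\<close>, the members of \<open>residual W M N\<close> are what
  Maker still misses of the winning sets that Breaker has not touched.\<close>

definition residual :: "'a set set \<Rightarrow> 'a set \<Rightarrow> 'a set \<Rightarrow> 'a set set" where
  "residual W M N = (\<lambda>B. B - M) ` {B \<in> W. B \<inter> N = {}}"

text \<open>\<open>F\<close> is the set of unclaimed points, \<open>W\<close> a residual family, and Maker is to move. Each round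
  removes one point for either player, so only positions with \<open>F\<close> of even size are safe.\<close>

inductive breaker_safe :: "'a set \<Rightarrow> 'a set set \<Rightarrow> bool" where
  breaker_safeI: "\<lbrakk>{} \<notin> W; \<forall>p\<in>F. \<exists>q\<in>F - {p}. breaker_safe (F - {p, q}) (residual W {p} {q})\<rbrakk>
     \<Longrightarrow> breaker_safe F W"

text \<open>The inner residual no longer shows the points of \<open>M\<close>, so a later Breaker
  point in \<open>M\<close> would go unnoticed; hence the disjointness.\<close>

lemma residual_residual:
  assumes "M \<inter> N' = {}"
  shows "residual (residual W M N) M' N' = residual W (M \<union> M') (N \<union> N')"
proof -
  have "(B - M) \<inter> N' = B \<inter> N'" for B
    using assms by blast
  then show ?thesis
    unfolding residual_def Compr_image_eq image_image
    by (intro image_cong) (simp_all add: Int_Un_distrib Diff_Un Diff_Int_distrib2 set_diff_eq conj_ac)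
qed

lemma residual_empty [simp]: "residual W {} {} = W"
  by (simp add: residual_def)

lemma residual_image:
  assumes "inj_on f S" "\<Union>W \<subseteq> S" "M \<subseteq> S" "N \<subseteq> S"
  shows "(`) f ` residual W M N = residual ((`) f ` W) (f ` M) (f ` N)"
proof -
  have "f ` (B - M) = f ` B - f ` M" "f ` B \<inter> f ` N = {} \<longleftrightarrow> B \<inter> N = {}" if "B \<in> W" for B
  proof -
    have "B \<subseteq> S"
      using that assms(2) by blast
    then show "f ` (B - M) = f ` B - f ` M" "f ` B \<inter> f ` N = {} \<longleftrightarrow> B \<inter> N = {}"
      using inj_on_image_set_diff[OF assms(1), of B M] inj_on_image_Int[OF assms(1), of B N] assms(3,4)
      by auto
  qed
  then show ?thesis
    unfolding residual_def Compr_image_eq image_image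
    by (intro image_cong Collect_cong conj_cong) simp_all
qed

text \<open>Carries the verdict on the concrete model over to an arbitrary design. Injectivity on
  \<open>S\<close> keeps claimed points apart and makes images commute with
  \<open>residual\<close>.\<close>

lemma breaker_safe_image:
  assumes "breaker_safe F W" "inj_on f S" "F \<subseteq> S" "\<Union>W \<subseteq> S"
  shows "breaker_safe (f ` F) ((`) f ` W)"
  using assms(1,3,4)
proof (induction rule: breaker_safe.induct)
  case (breaker_safeI W F)
  show ?case
  proof (rule breaker_safe.intros)
    show "{} \<notin> (`) f ` W"
      using breaker_safeI.hyps by auto
    show "\<forall>p\<in>f ` F. \<exists>q\<in>f ` F - {p}. breaker_safe (f ` F - {p, q}) (residual ((`) f ` W) {p} {q})"
    proof (intro ballI)
      fix p' assume "p' \<in> f ` F"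
      then obtain p where p: "p \<in> F" "p' = f p"
        by auto
      then obtain q where q: "q \<in> F - {p}" and
        IH: "F - {p, q} \<subseteq> S \<Longrightarrow> \<Union> (residual W {p} {q}) \<subseteq> S \<Longrightarrow>
           breaker_safe (f ` (F - {p, q})) ((`) f ` residual W {p} {q})"
        using breaker_safeI.IH by meson
      have "\<Union> (residual W {p} {q}) \<subseteq> S"
        using breaker_safeI.prems(2) by (auto simp: residual_def)
      then have "breaker_safe (f ` (F - {p, q})) ((`) f ` residual W {p} {q})"
        using IH breaker_safeI.prems(1) by blast
      moreover have "f ` (F - {p, q}) = f ` F - {f p, f q}"
        using assms(2) p q breaker_safeI.prems(1) by (auto simp: inj_on_def)
      moreover have "(`) f ` residual W {p} {q} = residual ((`) f ` W) {f p} {f q}"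
        using residual_image[OF assms(2) breaker_safeI.prems(2), of "{p}" "{q}"] p q
          breaker_safeI.prems(1) by auto
      moreover have "f q \<in> f ` F - {p'}"
        using q p assms(2) breaker_safeI.prems(1) by (auto simp: inj_on_def)
      ultimately show "\<exists>q\<in>f ` F - {p'}. breaker_safe (f ` F - {p', q}) (residual ((`) f ` W) {p'} {q})"
        using p(2) by metis
    qed
  qed
qed

section \<open>From safe positions to a strategy on histories\<close>

lemma maker_points_subset: "maker_points h \<subseteq> set h"
  by (auto simp: maker_points_def)

text \<open>Hence a win of Maker at any time \<open>t\<close> is still visible at the end of the
  play.\<close>

lemma maker_points_take: "maker_points (take t h) \<subseteq> maker_points h"
  by (fastforce simp: maker_points_def)

lemma maker_points_round:
  assumes "even (length h)"
  shows "maker_points (h @ [p, q]) = insert p (maker_points h)"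
proof -
  have "i < length (h @ [p, q]) \<and> even i \<longleftrightarrow> i < length h \<and> even i \<or> i = length h" for i
    using assms by (auto simp: less_Suc_eq)
  then have "maker_points (h @ [p, q]) = (\<lambda>i. (h @ [p, q]) ! i) ` ({i. i < length h \<and> even i} \<union> {length h})"
    unfolding maker_points_def setcompr_eq_image by (intro arg_cong[of _ _ "image _"]) auto
  also have "\<dots> = insert p ((\<lambda>i. (h @ [p, q]) ! i) ` {i. i < length h \<and> even i})"
    by simp
  also have "(\<lambda>i. (h @ [p, q]) ! i) ` {i. i < length h \<and> even i} = maker_points h"
    unfolding maker_points_def by (force simp: nth_append)
  finally show ?thesis .
qed

text \<open>Intended for histories of even length, because \<open>breaker_safe\<close> judges
  positions with Maker to move.\<close>

definition safe_history :: "'a set \<Rightarrow> 'a set set \<Rightarrow> 'a list \<Rightarrow> bool" where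
  "safe_history X W h \<longleftrightarrow>
     breaker_safe (X - set h) (residual W (maker_points h) (set h - maker_points h))"

lemma safe_history_reply:
  assumes "safe_history X W h" "even (length h)" "p \<in> X - set h"
  shows "\<exists>q\<in>X - set (h @ [p]). safe_history X W (h @ [p, q])"
proof -
  obtain q where q: "q \<in> X - set h - {p}" and safe: "breaker_safe (X - set h - {p, q})
      (residual (residual W (maker_points h) (set h - maker_points h)) {p} {q})"
    using assms(1,3) unfolding safe_history_def by (auto elim: breaker_safe.cases)
  have "residual (residual W (maker_points h) (set h - maker_points h)) {p} {q} =
     residual W (maker_points h \<union> {p}) (set h - maker_points h \<union> {q})"
    using assms(3) q maker_points_subset[of h] by (intro residual_residual) auto
  moreover have "set (h @ [p, q]) - maker_points (h @ [p, q]) = set h - maker_points h \<union> {q}"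
    using assms(2,3) q maker_points_subset[of h] by (auto simp: maker_points_round)
  moreover have "X - set (h @ [p, q]) = X - set h - {p, q}"
    by auto
  ultimately have "safe_history X W (h @ [p, q])"
    using safe by (simp add: safe_history_def maker_points_round assms(2))
  then show ?thesis
    using q by auto
qed

lemma breaker_can_win_if_safe:
  assumes "breaker_safe X W"
  shows "breaker_can_win X W"
proof -
  \<comment> \<open>Any reply that restores safety will do; on the histories that matter,
    \<open>safe_history_reply\<close> supplies one.\<close>
  define \<sigma> where "\<sigma> h = (SOME q. q \<in> X - set h \<and> safe_history X W (h @ [q]))" for h
  have legal: "\<sigma> (h @ [p]) \<in> X - set (h @ [p]) \<and> safe_history X W (h @ [p, \<sigma> (h @ [p])])"
    if "safe_history X W h" "even (length h)" "p \<in> X - set h" for h p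
  proof -
    have "\<exists>q. q \<in> X - set (h @ [p]) \<and> safe_history X W ((h @ [p]) @ [q])"
      using safe_history_reply[OF that] by auto
    from someI_ex[OF this] show ?thesis
      unfolding \<sigma>_def[symmetric] by simp
  qed
  have safe: "safe_history X W h"
    if "even (length h)" "is_play X h" "follows_breaker \<sigma> h" for h
    using that
  proof (induction "length h" arbitrary: h rule: less_induct)
    case less
    show ?case
    proof (cases "h = []")
      case True
      then show ?thesis
        using assms by (simp add: safe_history_def maker_points_def)
    next
      case False
      then obtain g q where g: "h = g @ [q]"
        by (metis rev_exhaust)
      then have "g \<noteq> []"
        using less.prems(1) by auto
      then obtain k p where h: "h = k @ [p, q]"
        using g by (metis append.assoc append_Cons append_Nil rev_exhaust)
      have "follows_breaker \<sigma> k"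
        unfolding follows_breaker_def
      proof (intro allI impI)
        fix i assume i: "i < length k" "odd i"
        then have "h ! i = \<sigma> (take i h)"
          using less.prems(3) by (simp add: follows_breaker_def h)
        then show "k ! i = \<sigma> (take i k)"
          using i by (simp add: h nth_append)
      qed
      moreover have "is_play X k" "p \<in> X - set k"
        using less.prems(2) by (auto simp: is_play_def h)
      moreover have "q = \<sigma> (k @ [p])"
      proof -
        have "h ! Suc (length k) = \<sigma> (take (Suc (length k)) h)"
          using less.prems(1,3) by (simp add: follows_breaker_def h)
        then show ?thesis
          by (simp add: h nth_append)
      qed
      moreover have "even (length k)" "length k < length h"
        using less.prems(1) by (auto simp: h)
      ultimately show ?thesis
        using less.hyps legal h by metis
    qed
  qed
  have odd_case: "\<sigma> h \<in> X - set h"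
    if "odd (length h)" "is_play X h" "follows_breaker \<sigma> h" for h
  proof -
    have "h \<noteq> []"
      using that(1) by auto
    then obtain k p where h: "h = k @ [p]"
      by (metis rev_exhaust)
    have "follows_breaker \<sigma> k"
      unfolding follows_breaker_def
    proof (intro allI impI)
      fix i assume i: "i < length k" "odd i"
      then have "h ! i = \<sigma> (take i h)"
        using that(3) by (simp add: follows_breaker_def h)
      then show "k ! i = \<sigma> (take i k)"
        using i by (simp add: h nth_append)
    qed
    moreover have "is_play X k" "p \<in> X - set k" "even (length k)"
      using that by (auto simp: is_play_def h)
    ultimately show ?thesis
      using safe legal h by blast
  qed
  have "breaker_wins_play X W h" if "is_play X h" "follows_breaker \<sigma> h" "set h = X" for h
    unfolding breaker_wins_play_def maker_wins_play_def
  proof (intro conjI notI that(3))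
    assume "\<exists>t\<le>length h. \<exists>B\<in>W. B \<subseteq> maker_points (take t h)"
    then obtain t B where "B \<in> W" "B \<subseteq> maker_points (take t h)"
      by blast
    then have B: "B \<in> W" "B \<subseteq> maker_points h"
      using maker_points_take[of t h] by auto
    \<comment> \<open>On a full board no point is left, whereas \<open>odd_case\<close> would yield
      a legal move after an odd history.\<close>
    have "even (length h)"
      using odd_case[OF _ that(1,2)] that(3) by blast
    then have "safe_history X W h"
      using safe[OF _ that(1,2)] by blast
    then have "{} \<notin> residual W (maker_points h) (set h - maker_points h)"
      unfolding safe_history_def by (cases rule: breaker_safe.cases)
    moreover have "B - maker_points h \<in> residual W (maker_points h) (set h - maker_points h)"
      unfolding residual_def using B by (intro imageI) auto
    ultimately show False
      using B(2) by (metis Diff_eq_empty_iff)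
  qed
  then have "breaker_winning_strategy X W \<sigma>"
    unfolding breaker_winning_strategy_def using odd_case by blast
  then show ?thesis
    unfolding breaker_can_win_def by blast
qed

subsection \<open>The Erdos-Selfridge criterion\<close>

definition danger :: "'a set set \<Rightarrow> real" where
  "danger W = (\<Sum>B\<in>W. (1 / 2) ^ card B)"

text \<open>Breaker takes \<open>q\<close>, then Maker takes \<open>p\<close>: sets through
  \<open>q\<close> vanish and surviving sets through \<open>p\<close> double. The danger thus falls
  by the share of \<open>q\<close> and rises by at most the share of \<open>p\<close>.\<close>

lemma danger_claim_le:
  assumes "finite W" "danger W < 1"
    and le: "danger {B \<in> W. p \<in> B} \<le> danger {B \<in> W. q \<in> B}"
  shows "danger (residual W {p} {q}) \<le> danger W"
proof -
  let ?w = "\<lambda>B. (1 / 2 :: real) ^ card B"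
  have fin: "finite B" if "B \<in> W" for B
  proof (rule ccontr)
    assume "infinite B"
    \<comment> \<open>\<open>card\<close> of an infinite set is 0.\<close>
    then have "?w B = 1"
      by simp
    moreover have "?w B \<le> danger W"
      unfolding danger_def using that assms(1) by (intro member_le_sum) auto
    ultimately show False
      using assms(2) by simp
  qed
  \<comment> \<open>Different sets may coincide once \<open>p\<close> is removed, so the sum over
    the image is bounded, not computed.\<close>
  have "danger (residual W {p} {q}) \<le> (\<Sum>B\<in>{B \<in> W. q \<notin> B}. ?w (B - {p}))"
    unfolding danger_def residual_def using assms(1)
    by (intro sum_image_le[THEN order_trans]) auto
  also have "\<dots> = (\<Sum>B\<in>{B \<in> W. q \<notin> B}. ?w B + (if p \<in> B then ?w B else 0))"
  proof (intro sum.cong refl)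
    fix B assume "B \<in> {B \<in> W. q \<notin> B}"
    then have "finite B"
      using fin by auto
    then show "?w (B - {p}) = ?w B + (if p \<in> B then ?w B else 0)"
      by (cases "card B") auto
  qed
  also have "\<dots> = danger {B \<in> W. q \<notin> B} + (\<Sum>B\<in>{B \<in> W. q \<notin> B}. if p \<in> B then ?w B else 0)"
    by (simp add: sum.distrib danger_def)
  also have "(\<Sum>B\<in>{B \<in> W. q \<notin> B}. if p \<in> B then ?w B else 0) \<le>
      (\<Sum>B\<in>W. if p \<in> B then ?w B else 0)"
    using assms(1) by (intro sum_mono2) auto
  also have "\<dots> = danger {B \<in> W. p \<in> B}"
    using assms(1) by (simp add: danger_def sum.inter_filter)
  also note le
  also have "danger {B \<in> W. q \<notin> B} + danger {B \<in> W. q \<in> B} = danger W"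
    unfolding danger_def using assms(1)
    by (subst sum.union_disjoint[symmetric]) (auto intro: sum.cong)
  finally show ?thesis
    by simp
qed

lemma obtain_max:
  fixes f :: "'a \<Rightarrow> real"
  assumes "finite F" "F \<noteq> {}"
  obtains q where "q \<in> F" "\<And>p. p \<in> F \<Longrightarrow> f p \<le> f q"
proof -
  have "Max (f ` F) \<in> f ` F"
    using assms by (intro Max_in) auto
  then obtain q where q: "q \<in> F" "f q = Max (f ` F)"
    by auto
  then show thesis
    using assms(1) by (intro that[of q]) auto
qed

text \<open>Breaker claims a point \<open>q\<close> of maximal danger: Maker's next point then doubles at most as much
  danger as \<open>q\<close> has destroyed.\<close>

lemma erdos_selfridge:
  assumes "finite F" "odd (card F)" "finite W" "danger W < 1"
  shows "\<exists>q\<in>F. breaker_safe (F - {q}) (residual W {} {q})"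
  using assms
proof (induction "card F" arbitrary: F W rule: less_induct)
  case less
  have "F \<noteq> {}"
    using less.prems(2) by auto
  then obtain q where q: "q \<in> F" and
    max: "\<And>p. p \<in> F \<Longrightarrow> danger {B \<in> W. p \<in> B} \<le> danger {B \<in> W. q \<in> B}"
    using less.prems(1) obtain_max[of F "\<lambda>p. danger {B \<in> W. p \<in> B}"] by blast
  have "breaker_safe (F - {q}) (residual W {} {q})"
  proof (rule breaker_safe.intros)
    show "{} \<notin> residual W {} {q}"
    proof
      assume "{} \<in> residual W {} {q}"
      then have "{} \<in> W"
        by (auto simp: residual_def)
      then have "(1 / 2 :: real) ^ card ({} :: 'a set) \<le> danger W"
        unfolding danger_def using less.prems(3) by (intro member_le_sum) auto
      then show False
        using less.prems(4) by simp
    qed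
    show "\<forall>p\<in>F - {q}. \<exists>r\<in>F - {q} - {p}.
        breaker_safe (F - {q} - {p, r}) (residual (residual W {} {q}) {p} {r})"
    proof (intro ballI)
      fix p assume p: "p \<in> F - {q}"
      have "card {q, p} \<le> card F" "card (F - {q, p}) = card F - card {q, p}"
        using p q less.prems(1) by (auto intro!: card_mono card_Diff_subset)
      moreover have "card {q, p} = 2"
        using p by (auto simp: card_insert_if)
      ultimately have card: "card F = card (F - {q, p}) + 2"
        by linarith
      have "danger (residual W {p} {q}) < 1"
        using danger_claim_le[OF less.prems(3,4) max] p less.prems(4) by fastforce
      moreover have "finite (residual W {p} {q})"
        using less.prems(3) by (simp add: residual_def)
      moreover have "card (F - {q, p}) < card F" "odd (card (F - {q, p}))" "finite (F - {q, p})"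
        using card less.prems(1,2) by auto
      ultimately obtain r where r: "r \<in> F - {q, p}"
          "breaker_safe (F - {q, p} - {r}) (residual (residual W {p} {q}) {} {r})"
        using less.hyps[of "F - {q, p}" "residual W {p} {q}"] by blast
      \<comment> \<open>The same three claims bracketed in two ways: the induction pairs
        \<open>q\<close> with Maker's following \<open>p\<close>, while \<open>breaker_safe\<close>
        pairs \<open>p\<close> with the answer \<open>r\<close>.\<close>
      moreover have "residual (residual W {p} {q}) {} {r} = residual (residual W {} {q}) {p} {r}"
        using p r(1) by (simp add: residual_residual insert_commute)
      moreover have "F - {q, p} - {r} = F - {q} - {p, r}"
        by auto
      ultimately show "\<exists>r\<in>F - {q} - {p}.
        breaker_safe (F - {q} - {p, r}) (residual (residual W {} {q}) {p} {r})"
        by (intro bexI[of _ r]) auto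
    qed
  qed
  then show ?case
    using q by blast
qed

subsection \<open>Evaluating the greedy strategy\<close>

text \<open>\<open>weight b\<close> is \<open>16 / 2 ^ length b\<close>, rounded up to an integer.\<close>

fun weight :: "'a list \<Rightarrow> int" where
  "weight [] = 16"
| "weight [_] = 8"
| "weight [_, _] = 4"
| "weight [_, _, _] = 2"
| "weight (_ # _ # _ # _ # _) = 1"

definition potential :: "'a list list \<Rightarrow> int" where
  "potential bs = sum_list (map weight bs)"

definition degree :: "'a list list \<Rightarrow> 'a \<Rightarrow> int" where
  "degree bs q = potential (filter (\<lambda>b. q \<in> set b) bs)"

text \<open>The strict comparison keeps the earlier of two points of equal degree.\<close>

fun heaviest :: "'a list list \<Rightarrow> 'a \<Rightarrow> 'a list \<Rightarrow> 'a" where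
  "heaviest bs q [] = q"
| "heaviest bs q (r # rs) = heaviest bs (if degree bs q < degree bs r then r else q) rs"

definition play_round :: "'a \<Rightarrow> 'a \<Rightarrow> 'a list list \<Rightarrow> 'a list list" where
  "play_round p q bs = map (remove1 p) (filter (\<lambda>b. q \<notin> set b) bs)"

text \<open>Breaker is to move. The search stops as soon as the Erdos-Selfridge bound applies. The test
  \<open>[] \<in> set bs\<close> matters only when \<open>F\<close> has a single point left. The nested conditionals, unlike
  \<open>\<or>\<close> and \<open>\<and>\<close>, keep \<open>code_simp\<close> from unfolding the recursive call before it is needed.\<close>

fun greedy_holds :: "nat \<Rightarrow> 'a list \<Rightarrow> 'a list list \<Rightarrow> bool" where
  "greedy_holds 0 F bs = (potential bs < 16)"
| "greedy_holds (Suc n) F bs =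
     (if potential bs < 16 then True
      else if [] \<in> set bs then False
      else let q = heaviest bs (hd F) (tl F); F' = remove1 q F
        in list_all (\<lambda>p. greedy_holds n (remove1 p F') (play_round p q bs)) F')"

lemma half_power_le_weight: "16 * (1 / 2 :: real) ^ length b \<le> weight b"
proof (induction b rule: weight.induct)
  case (5 u v w x b)
  have "(1 / 2 :: real) ^ length b \<le> 1"
    by (simp add: power_le_one)
  then show ?case
    by (simp add: power_divide)
qed simp_all

text \<open>Only an upper bound: lists with the same set of points are counted separately, and
  \<open>weight\<close> rounds up.\<close>

lemma danger_le_potential:
  assumes "\<forall>b\<in>set bs. distinct b"
  shows "16 * danger (set ` set bs) \<le> potential bs"
proof -
  have "danger (set ` set bs) \<le> (\<Sum>b\<in>set bs. (1 / 2) ^ card (set b))"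
    unfolding danger_def by (intro sum_image_le[THEN order_trans]) auto
  also have "\<dots> = (\<Sum>b\<in>set bs. (1 / 2) ^ length b)"
    using assms by (intro sum.cong) (auto simp: distinct_card)
  also have "\<dots> \<le> (\<Sum>b\<leftarrow>bs. (1 / 2) ^ length b)"
  proof (induction bs)
    case (Cons b bs)
    then show ?case
      by (cases "b \<in> set bs") (auto simp: insert_absorb add_increasing)
  qed simp
  finally have "16 * danger (set ` set bs) \<le> 16 * (\<Sum>b\<leftarrow>bs. (1 / 2) ^ length b)"
    by simp
  also have "\<dots> \<le> potential bs"
    unfolding potential_def
  proof (induction bs)
    case (Cons b bs)
    then show ?case
      using half_power_le_weight[of b] by (simp add: distrib_left)
  qed simp
  finally show ?thesis .
qed

lemma heaviest_in: "heaviest bs q rs \<in> insert q (set rs)"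
  by (induction bs q rs rule: heaviest.induct) (auto split: if_splits)

lemma residual_play_round:
  assumes "\<forall>b\<in>set bs. distinct b"
  shows "set ` set (play_round p q bs) = residual (set ` set bs) {p} {q}"
  using assms unfolding residual_def Compr_image_eq play_round_def set_map set_filter image_image
  by (intro image_cong) auto

text \<open>Breaker's choice enters through \<open>heaviest_in\<close>: any point of
  \<open>F\<close> is a legal reply, and the greedy rule decides only whether the search succeeds.
  Each round removes two points, which preserves odd length.\<close>

lemma greedy_holds_sound:
  assumes "greedy_holds n F bs" "distinct F" "odd (length F)" "\<forall>b\<in>set bs. distinct b"
  shows "\<exists>q\<in>set F. breaker_safe (set F - {q}) (residual (set ` set bs) {} {q})"
  using assms
proof (induction n F bs rule: greedy_holds.induct)
  case (1 F bs)
  then show ?case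
    using danger_le_potential[of bs] by (intro erdos_selfridge) (auto simp: distinct_card)
next
  case (2 n F bs)
  show ?case
  proof (cases "potential bs < 16")
    case True
    then show ?thesis
      using danger_le_potential[of bs] 2(3-5) by (intro erdos_selfridge) (auto simp: distinct_card)
  next
    case False
    define q where "q = heaviest bs (hd F) (tl F)"
    have "F \<noteq> []"
      using 2(4) by auto
    then have q: "q \<in> set F"
      unfolding q_def using heaviest_in[of bs "hd F" "tl F"] by (metis list.collapse list.simps(15))
    have nil: "[] \<notin> set bs" and
      play: "\<And>p. p \<in> set (remove1 q F) \<Longrightarrow> greedy_holds n (remove1 p (remove1 q F)) (play_round p q bs)"
      using 2(2) False by (auto simp: q_def Let_def list_all_iff split: if_splits)
    have "breaker_safe (set F - {q}) (residual (set ` set bs) {} {q})"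
    proof (rule breaker_safe.intros)
      show "{} \<notin> residual (set ` set bs) {} {q}"
        using nil by (auto simp: residual_def)
      show "\<forall>p\<in>set F - {q}. \<exists>r\<in>set F - {q} - {p}. breaker_safe (set F - {q} - {p, r})
          (residual (residual (set ` set bs) {} {q}) {p} {r})"
      proof (intro ballI)
        fix p assume p: "p \<in> set F - {q}"
        let ?F = "remove1 p (remove1 q F)"
        have p': "p \<in> set (remove1 q F)"
          using p by auto
        have "length F > 0" "length (remove1 q F) > 0"
          using q p' length_pos_if_in_set by metis+
        moreover have "length (remove1 q F) = length F - 1" "length ?F = length (remove1 q F) - 1"
          using q p' by (simp_all add: length_remove1)
        ultimately have "odd (length ?F)"
          using 2(4) by presburger
        moreover have "distinct ?F" "\<forall>b\<in>set (play_round p q bs). distinct b"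
          using 2(3,5) by (auto simp: play_round_def)
        ultimately obtain r where r: "r \<in> set ?F"
          "breaker_safe (set ?F - {r}) (residual (set ` set (play_round p q bs)) {} {r})"
          using 2(1)[OF False nil q_def refl] p' play by blast
        have F: "set ?F = set F - {q} - {p}"
          using 2(3) by auto
        then have "set ?F - {r} = set F - {q} - {p, r}"
          by auto
        moreover have "residual (set ` set (play_round p q bs)) {} {r} =
            residual (residual (set ` set bs) {} {q}) {p} {r}"
          unfolding residual_play_round[OF 2(5)] using p r(1) F
          by (simp add: residual_residual insert_commute)
        ultimately show "\<exists>r\<in>set F - {q} - {p}. breaker_safe (set F - {q} - {p, r})
          (residual (residual (set ` set bs) {} {q}) {p} {r})"
          using r F by metis
      qed
    qed
    then show ?thesis
      using q by blast
  qed
qed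

text \<open>Over the field with four elements, coded as \<open>0, 1, 2, 3\<close>, the blocks are
  \<open>{i, 4 + j, 8 + k, 12 + l}\<close>, where \<open>k = i + j\<close> and \<open>l = 2 * i + j\<close> are computed in the field.\<close>

definition model :: "nat list list" where
  "model = [[0, 4, 8, 12], [0, 5, 9, 13], [0, 6, 10, 14], [0, 7, 11, 15],
   [1, 4, 9, 14], [1, 5, 8, 15], [1, 6, 11, 12], [1, 7, 10, 13],
   [2, 4, 10, 15], [2, 5, 11, 14], [2, 6, 8, 13], [2, 7, 9, 12],
   [3, 4, 11, 13], [3, 5, 10, 12], [3, 6, 9, 15], [3, 7, 8, 14]]"

text \<open>The list fixes how Breaker breaks ties among points of maximal degree; most orders fail, this
  one was found by a computer search.\<close>

lemma greedy_holds_model: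
  "greedy_holds 7 [15, 12, 13, 14, 8, 4, 5, 9, 2, 11, 10, 7, 3, 6, 1] (map (remove1 0) model)"
  by code_simp

text \<open>A single opening suffices, because \<open>model_coordinates\<close> can give the label 0
  to any point of a design.\<close>

lemma model_answer:
  "\<exists>q\<in>{..<16} - {0}. breaker_safe ({..<16} - {0, q}) (residual (set ` set model) {0} {q})"
proof -
  let ?F = "[15, 12, 13, 14, 8, 4, 5, 9, 2, 11, 10, 7, 3, 6, 1] :: nat list"
  have F: "set ?F = {..<16} - {0}"
    by (auto simp: lessThan_nat_numeral)
  have dist: "\<forall>b\<in>set model. distinct b"
    by (simp add: model_def)
  have "\<exists>q\<in>set ?F. breaker_safe (set ?F - {q})
      (residual (set ` set (map (remove1 0) model)) {} {q})"
    using dist by (intro greedy_holds_sound[OF greedy_holds_model]) auto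
  moreover have "set ` set (map (remove1 0) model) = residual (set ` set model) {0} {}"
    using dist unfolding residual_def Compr_image_eq set_map image_image
    by (intro image_cong) auto
  ultimately obtain q where q: "q \<in> {..<16} - {0}"
    "breaker_safe ({..<16} - {0} - {q}) (residual (residual (set ` set model) {0} {}) {} {q})"
    unfolding F by metis
  moreover have "{..<16} - {0} - {q} = {..<16} - {0, q}"
    by blast
  ultimately show ?thesis
    by (intro bexI[of _ q]) (simp_all add: residual_residual)
qed

subsection \<open>Orthogonal Latin squares of order 4\<close>

abbreviation (input) clear :: "'a list \<Rightarrow> 'a list \<Rightarrow> bool" where
  "clear \<equiv> list_all2 (\<noteq>)"

text \<open>The candidates for a row below \<open>[0, 1, 2, 3]\<close> in a Latin square, three for
  each possible first entry.\<close>

definition derangements :: "nat list list" where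
  "derangements = [[1, 0, 3, 2], [1, 2, 3, 0], [1, 3, 0, 2], [2, 0, 3, 1], [2, 3, 0, 1],
    [2, 3, 1, 0], [3, 0, 1, 2], [3, 2, 0, 1], [3, 2, 1, 0]]"

lemma derangement:
  assumes "set r \<subseteq> {0, 1, 2, 3}" "distinct r" "clear [0, 1, 2, 3] r"
  shows "r \<in> set derangements"
proof -
  obtain a b c d where r: "r = [a, b, c, d]"
    using assms(3) by (auto simp: list_all2_Cons1)
  have "a \<in> {1, 2, 3}" "b \<in> {0, 2, 3}" "c \<in> {0, 1, 3}" "d \<in> {0, 1, 2}"
    using assms unfolding r by auto
  moreover have "distinct [a, b, c, d]"
    using assms(2) by (simp add: r)
  ultimately show ?thesis
    unfolding derangements_def r by (elim insertE emptyE) simp_all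
qed

text \<open>\<open>l1, l2, l3\<close> and \<open>m1, m2, m3\<close> are the rows below \<open>[0, 1, 2, 3]\<close> of the two squares; \<open>clear l m\<close> is
  orthogonality with the common first row.\<close>

definition orthogonal_squares :: "(nat list list \<times> nat list list) list" where
  "orthogonal_squares = [([l1, l2, l3], [m1, m2, m3]).
     l1 \<leftarrow> derangements, hd l1 = 1,
     l2 \<leftarrow> derangements, hd l2 = 2 \<and> clear l1 l2,
     l3 \<leftarrow> derangements, hd l3 = 3 \<and> clear l1 l3 \<and> clear l2 l3,
     m1 \<leftarrow> derangements, clear l1 m1,
     m2 \<leftarrow> derangements, clear l2 m2 \<and> clear m1 m2,
     m3 \<leftarrow> derangements, clear l3 m3 \<and> clear m1 m3 \<and> clear m2 m3,
     distinct (zip (l1 @ l2 @ l3) (m1 @ m2 @ m3))]"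

text \<open>In the first square only the table of the Klein four-group survives,
  \<open>i + j\<close> over the field with four elements; its partners are \<open>2 * i + j\<close>
  and \<open>3 * i + j\<close>.\<close>

lemma orthogonal_squares:
  "orthogonal_squares =
   [([[1, 0, 3, 2], [2, 3, 0, 1], [3, 2, 1, 0]], [[2, 3, 0, 1], [3, 2, 1, 0], [1, 0, 3, 2]]),
    ([[1, 0, 3, 2], [2, 3, 0, 1], [3, 2, 1, 0]], [[3, 2, 1, 0], [1, 0, 3, 2], [2, 3, 0, 1]])]"
  by code_simp

text \<open>The groups are the four intervals of four consecutive labels; every cell of the two
  squares becomes one block.\<close>

definition grid :: "(nat \<Rightarrow> nat \<Rightarrow> nat) \<Rightarrow> (nat \<Rightarrow> nat \<Rightarrow> nat) \<Rightarrow> nat list list" where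
  "grid L M = [[i, 4 + j, 8 + L i j, 12 + M i j]. i \<leftarrow> [0, 1, 2, 3], j \<leftarrow> [0, 1, 2, 3]]"

text \<open>The Frobenius automorphism of the field, acting on each group; it exchanges the two possible
  second squares.\<close>

definition conjugation :: "nat \<Rightarrow> nat" where
  "conjugation v = [0, 1, 3, 2, 4, 5, 7, 6, 8, 9, 11, 10, 12, 13, 15, 14] ! v"

text \<open>The conclusion has the form into which a generator with a guard is expanded in a list
  comprehension.\<close>

lemma in_set_comprehension:
  "\<lbrakk>x \<in> set xs; P x; y \<in> set (f x)\<rbrakk> \<Longrightarrow> y \<in> set (concat (map (\<lambda>x. if P x then f x else []) xs))"
  by auto

lemma orthogonal_squaresI:
  assumes "distinct (zip (l1 @ l2 @ l3) (m1 @ m2 @ m3))" "hd l1 = 1" "hd l2 = 2" "hd l3 = 3"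
    "l1 \<in> set derangements" "l2 \<in> set derangements" "l3 \<in> set derangements"
    "m1 \<in> set derangements" "m2 \<in> set derangements" "m3 \<in> set derangements"
    "clear l1 l2" "clear l1 l3" "clear l2 l3" "clear m1 m2" "clear m1 m3" "clear m2 m3"
    "clear l1 m1" "clear l2 m2" "clear l3 m3"
  shows "([l1, l2, l3], [m1, m2, m3]) \<in> set orthogonal_squares"
  unfolding orthogonal_squares_def
  by (rule in_set_comprehension[of l1] in_set_comprehension[of l2] in_set_comprehension[of l3]
      in_set_comprehension[of m1] in_set_comprehension[of m2] in_set_comprehension[of m3],
      use assms in simp, use assms in simp)+ (use assms in simp)

lemma derangement_row:
  fixes f :: "nat \<Rightarrow> nat"
  assumes "\<And>j. j < 4 \<Longrightarrow> f j < 4" "\<And>j j'. \<lbrakk>j < 4; j' < 4; f j = f j'\<rbrakk> \<Longrightarrow> j = j'"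
    and "\<And>j. j < 4 \<Longrightarrow> f j \<noteq> j"
  shows "map f [0, 1, 2, 3] \<in> set derangements"
proof (rule derangement)
  have lt: "v \<in> {0, 1, 2, 3}" if "v < 4" for v :: nat
    using that by auto
  show "set (map f [0, 1, 2, 3]) \<subseteq> {0, 1, 2, 3}"
    using lt assms(1) by simp
  have "inj_on f {..<4}"
    using assms(2) by (intro inj_onI) simp
  then have "inj_on f (set [0, 1, 2, 3])"
    by (rule inj_on_subset) simp
  then show "distinct (map f [0, 1, 2, 3])"
    by (simp only: distinct_map) simp
  show "clear [0, 1, 2, 3] (map f [0, 1, 2, 3])"
    using assms(3)[of 0] assms(3)[of 1] assms(3)[of 2] assms(3)[of 3] by simp
qed

lemma clear_map:
  fixes f g :: "nat \<Rightarrow> nat"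
  assumes "\<And>j. j < 4 \<Longrightarrow> f j \<noteq> g j"
  shows "clear (map f [0, 1, 2, 3]) (map g [0, 1, 2, 3])"
  using assms by simp

lemma orthogonal_latin_squares:
  fixes L M :: "nat \<Rightarrow> nat \<Rightarrow> nat"
  assumes range: "\<And>i j. \<lbrakk>i < 4; j < 4\<rbrakk> \<Longrightarrow> L i j < 4" "\<And>i j. \<lbrakk>i < 4; j < 4\<rbrakk> \<Longrightarrow> M i j < 4"
    and reduced: "\<And>j. j < 4 \<Longrightarrow> L 0 j = j" "\<And>i. i < 4 \<Longrightarrow> L i 0 = i"
      "\<And>j. j < 4 \<Longrightarrow> M 0 j = j"
    and rows: "\<And>i j j'. \<lbrakk>i < 4; j < 4; j' < 4; L i j = L i j'\<rbrakk> \<Longrightarrow> j = j'"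
      "\<And>i j j'. \<lbrakk>i < 4; j < 4; j' < 4; M i j = M i j'\<rbrakk> \<Longrightarrow> j = j'"
    and columns: "\<And>i i' j. \<lbrakk>i < 4; i' < 4; j < 4; L i j = L i' j\<rbrakk> \<Longrightarrow> i = i'"
      "\<And>i i' j. \<lbrakk>i < 4; i' < 4; j < 4; M i j = M i' j\<rbrakk> \<Longrightarrow> i = i'"
    and orth: "\<And>i j i' j'. \<lbrakk>i < 4; j < 4; i' < 4; j' < 4; L i j = L i' j'; M i j = M i' j'\<rbrakk>
      \<Longrightarrow> i = i' \<and> j = j'"
  shows "grid L M = model \<or> set ` set (grid L M) = (`) conjugation ` set ` set model"
proof -
  let ?r = "\<lambda>N i. map (N i) [0, 1, 2, 3] :: nat list"
  have L: "?r L i \<in> set derangements" and M: "?r M i \<in> set derangements"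
    if "i < 4" "i \<noteq> 0" for i
  proof -
    have ne: "L i j \<noteq> j" "M i j \<noteq> j" if "j < 4" for j
      using reduced(1,3)[OF that] columns[of i 0 j] that \<open>i < 4\<close> \<open>i \<noteq> 0\<close> by auto
    show "?r L i \<in> set derangements"
      by (rule derangement_row; use ne(1) range(1) rows(1) \<open>i < 4\<close> in blast)
    show "?r M i \<in> set derangements"
      by (rule derangement_row; use ne(2) range(2) rows(2) \<open>i < 4\<close> in blast)
  qed
  have clear_L: "clear (?r L i) (?r L i')" and clear_M: "clear (?r M i) (?r M i')"
    if "i < 4" "i' < 4" "i \<noteq> i'" for i i'
    using columns[OF that(1,2)] that(3) by (blast intro: clear_map)+
  \<comment> \<open>If both squares had the entry \<open>v\<close> in a cell of row
    \<open>i\<close>, that cell would repeat the pair \<open>(v, v)\<close> of cell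
    \<open>(0, v)\<close>.\<close>
  have clear_orth: "clear (?r L i) (?r M i)" if "i < 4" "i \<noteq> 0" for i
  proof (rule clear_map, rule notI)
    fix j assume "j < (4::nat)" "L i j = M i j"
    then show False
      using orth[of 0 "L i j" i j] reduced(1,3)[of "L i j"] range(1)[of i j] that by simp
  qed
  have "distinct (zip (?r L 1 @ ?r L 2 @ ?r L 3) (?r M 1 @ ?r M 2 @ ?r M 3))"
  proof -
    let ?cells = "[(1, 0), (1, 1), (1, 2), (1, 3), (2, 0), (2, 1), (2, 2), (2, 3),
        (3, 0), (3, 1), (3, 2), (3, 3)] :: (nat \<times> nat) list"
    have "zip (?r L 1 @ ?r L 2 @ ?r L 3) (?r M 1 @ ?r M 2 @ ?r M 3) =
      map (\<lambda>(i, j). (L i j, M i j)) ?cells"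
      by simp
    moreover have "inj_on (\<lambda>(i, j). (L i j, M i j)) ({..<4} \<times> {..<4})"
      by (rule inj_onI) (clarsimp, blast dest: orth)
    then have "inj_on (\<lambda>(i, j). (L i j, M i j)) (set ?cells)"
      by (rule inj_on_subset) simp
    ultimately show ?thesis
      by (simp only: distinct_map) simp
  qed
  then have "([?r L 1, ?r L 2, ?r L 3], [?r M 1, ?r M 2, ?r M 3]) \<in> set orthogonal_squares"
  proof (rule orthogonal_squaresI)
    show "hd (?r L 1) = 1" "hd (?r L 2) = 2" "hd (?r L 3) = 3"
      using reduced(2) by simp_all
  qed (rule L M clear_L clear_M clear_orth; simp)+
  then have "(?r L 1 = [1, 0, 3, 2] \<and> ?r L 2 = [2, 3, 0, 1] \<and> ?r L 3 = [3, 2, 1, 0]) \<and>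
     (?r M 1 = [2, 3, 0, 1] \<and> ?r M 2 = [3, 2, 1, 0] \<and> ?r M 3 = [1, 0, 3, 2] \<or>
      ?r M 1 = [3, 2, 1, 0] \<and> ?r M 2 = [1, 0, 3, 2] \<and> ?r M 3 = [2, 3, 0, 1])"
    by (simp only: orthogonal_squares list.set insert_iff empty_iff prod.inject list.inject) blast
  then consider "?r L 1 = [1, 0, 3, 2]" "?r L 2 = [2, 3, 0, 1]" "?r L 3 = [3, 2, 1, 0]"
      "?r M 1 = [2, 3, 0, 1]" "?r M 2 = [3, 2, 1, 0]" "?r M 3 = [1, 0, 3, 2]"
    | "?r L 1 = [1, 0, 3, 2]" "?r L 2 = [2, 3, 0, 1]" "?r L 3 = [3, 2, 1, 0]"
      "?r M 1 = [3, 2, 1, 0]" "?r M 2 = [1, 0, 3, 2]" "?r M 3 = [2, 3, 0, 1]"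
    by blast
  then show ?thesis
  proof cases
    case 1
    then have "grid L M = model"
      using reduced(1,3) by (simp add: grid_def model_def)
    then show ?thesis ..
  next
    case 2
    then have "grid L M = [[0, 4, 8, 12], [0, 5, 9, 13], [0, 6, 10, 14], [0, 7, 11, 15],
      [1, 4, 9, 15], [1, 5, 8, 14], [1, 6, 11, 13], [1, 7, 10, 12],
      [2, 4, 10, 13], [2, 5, 11, 12], [2, 6, 8, 15], [2, 7, 9, 14],
      [3, 4, 11, 14], [3, 5, 10, 15], [3, 6, 9, 12], [3, 7, 8, 13]]"
      using reduced(1,3) by (simp add: grid_def)
    \<comment> \<open>Only the sets agree, since \<open>conjugation\<close> also permutes the rows
      and columns of the grid.\<close>
    also have "set \<dots> = set (map (map conjugation) model)"
      by code_simp
    finally have "set ` set (grid L M) = (`) conjugation ` set ` set model"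
      by (simp add: image_image)
    then show ?thesis ..
  qed
qed

subsection \<open>Coordinates in a transversal design\<close>

context transversal_design
begin

definition line :: "'a \<Rightarrow> 'a \<Rightarrow> 'a set" where
  "line u v = (THE B. B \<in> \<B> \<and> u \<in> B \<and> v \<in> B)"

definition meet :: "'a set \<Rightarrow> 'a set \<Rightarrow> 'a" where
  "meet B G = (THE v. v \<in> B \<and> v \<in> G)"

lemma group_eq: "\<lbrakk>G \<in> \<G>; H \<in> \<G>; v \<in> G; v \<in> H\<rbrakk> \<Longrightarrow> G = H"
  using groups_partition by (auto simp: partition_on_def disjoint_def)

lemma group_subset: "G \<in> \<G> \<Longrightarrow> G \<subseteq> X"
  using groups_partition by (auto simp: partition_on_def)

lemma line_ex1:
  assumes "G \<in> \<G>" "H \<in> \<G>" "G \<noteq> H" "u \<in> G" "v \<in> H"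
  shows "\<exists>!B. B \<in> \<B> \<and> u \<in> B \<and> v \<in> B"
proof (rule unique_block)
  show "u \<in> X" "v \<in> X"
    using assms group_subset by auto
  show "\<not> (\<exists>K\<in>\<G>. u \<in> K \<and> v \<in> K)"
    using assms group_eq by blast
qed

lemma line:
  assumes "G \<in> \<G>" "H \<in> \<G>" "G \<noteq> H" "u \<in> G" "v \<in> H"
  shows "line u v \<in> \<B>" "u \<in> line u v" "v \<in> line u v"
  using theI'[OF line_ex1[OF assms]] unfolding line_def by auto

lemma line_eq:
  assumes "G \<in> \<G>" "H \<in> \<G>" "G \<noteq> H" "u \<in> G" "v \<in> H" "B \<in> \<B>" "u \<in> B" "v \<in> B"
  shows "line u v = B"
  unfolding line_def using line_ex1[OF assms(1-5)] assms(6-8) by (intro the1_equality) auto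

lemma block_eq:
  assumes "G \<in> \<G>" "H \<in> \<G>" "G \<noteq> H" "u \<in> G" "v \<in> H"
    "B \<in> \<B>" "u \<in> B" "v \<in> B" "C \<in> \<B>" "u \<in> C" "v \<in> C"
  shows "B = C"
  using line_eq[OF assms(1-5)] assms(6-11) by metis

text \<open>By counting: the \<open>k\<close> points of a block lie in different groups, and there
  are only \<open>k\<close> groups.\<close>

lemma block_meets_group:
  assumes "B \<in> \<B>" "G \<in> \<G>"
  obtains v where "v \<in> B" "v \<in> G"
proof -
  have "\<forall>v\<in>B. \<exists>H. H \<in> \<G> \<and> v \<in> H"
    using block_subset[OF assms(1)] groups_partition by (auto simp: partition_on_def)
  then obtain g where g: "\<And>v. v \<in> B \<Longrightarrow> g v \<in> \<G> \<and> v \<in> g v"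
    by metis
  have "inj_on g B"
    using g block_transversal[OF assms(1)] by (metis inj_onI)
  then have "card (g ` B) = card \<G>"
    by (simp add: card_image card_block[OF assms(1)] card_groups)
  moreover have "finite \<G>"
    using finite_elements[OF finite_points groups_partition] .
  ultimately have "g ` B = \<G>"
    using g by (intro card_subset_eq) auto
  then show thesis
    using g assms(2) that by blast
qed

lemma meet:
  assumes "B \<in> \<B>" "G \<in> \<G>"
  shows "meet B G \<in> B" "meet B G \<in> G"
proof -
  obtain v where v: "v \<in> B" "v \<in> G"
    using block_meets_group[OF assms] .
  have "\<exists>!v. v \<in> B \<and> v \<in> G"
    using v block_transversal[OF assms] by blast
  then show "meet B G \<in> B" "meet B G \<in> G"
    unfolding meet_def using theI'[of "\<lambda>v. v \<in> B \<and> v \<in> G"] by auto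
qed

lemma meet_eq: "\<lbrakk>B \<in> \<B>; G \<in> \<G>; v \<in> B; v \<in> G\<rbrakk> \<Longrightarrow> meet B G = v"
  using meet block_transversal by blast

lemma finite_group: "G \<in> \<G> \<Longrightarrow> finite G"
  using group_subset finite_points finite_subset by blast

text \<open>Projection from the centre \<open>u\<close> along blocks. Blocks through
  \<open>u\<close> that share a point of \<open>H\<close> coincide, so the map is injective, and
  \<open>H\<close> has \<open>n\<close> points.\<close>

lemma perspective:
  assumes "G \<in> \<G>" "H \<in> \<G>" "K \<in> \<G>" "K \<noteq> G" "K \<noteq> H" "u \<in> K" "bij_betw b {..<n} G"
  shows "bij_betw (\<lambda>j. meet (line u (b j)) H) {..<n} H"
proof -
  let ?f = "\<lambda>j. meet (line u (b j)) H"
  have b: "b j \<in> G" if "j < n" for j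
    using assms(7) that by (auto simp: bij_betw_def)
  have l: "line u (b j) \<in> \<B>" "u \<in> line u (b j)" "b j \<in> line u (b j)" if "j < n" for j
    using line[OF assms(3,1,4,6) b[OF that]] .
  have "inj_on ?f {..<n}"
  proof (rule inj_onI)
    fix i j assume "i \<in> {..<n}" "j \<in> {..<n}" and eq: "?f i = ?f j"
    then have ij: "i < n" "j < n"
      by auto
    have "line u (b i) = line u (b j)"
      using block_eq[OF assms(3,2,5,6), of "?f i"] l meet[OF _ assms(2)] ij eq by metis
    then have "b i = b j"
      using block_transversal[OF l(1)[OF ij(1)] assms(1)] l(3) b ij by metis
    then show "i = j"
      using assms(7) ij by (auto simp: bij_betw_def inj_on_def)
  qed
  moreover have "?f ` {..<n} = H"
  proof (rule card_subset_eq)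
    show "finite H"
      using finite_group assms(2) .
    show "?f ` {..<n} \<subseteq> H"
      using meet(2) l(1) assms(2) by auto
    show "card (?f ` {..<n}) = card H"
      using card_image[OF \<open>inj_on ?f {..<n}\<close>] card_group[OF assms(2)] by simp
  qed
  ultimately show ?thesis
    by (simp add: bij_betw_def)
qed

end

section \<open>Identification of the design with the model\<close>

lemma set_grid:
  "set (grid L M) = (\<lambda>(i, j). [i, 4 + j, 8 + L i j, 12 + M i j]) ` ({..<4} \<times> {..<4})"
proof -
  have "{..<4} = set [0, 1, 2, 3 :: nat]"
    by auto
  then show ?thesis
    unfolding grid_def by auto
qed

lemma bij_betw_conjugation: "bij_betw conjugation {..<16} {..<16}"
proof -
  have "{..<16} = set [0..<16]"
    by auto
  moreover have "distinct (map conjugation [0..<16]) \<and> set (map conjugation [0..<16]) = set [0..<16]"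
    by code_simp
  ultimately show ?thesis
    unfolding bij_betw_def by (simp only: distinct_map set_map)
qed

text \<open>The block through \<open>a i\<close> and \<open>b j\<close> meets the third and fourth
  group in one point each; their labels are the entries of \<open>L\<close> and \<open>M\<close> in
  cell \<open>(i, j)\<close>.\<close>

lemma coordinates:
  fixes X :: "'a set"
  assumes "transversal_design 4 4 X \<G> \<B>" "x \<in> X"
  obtains f L M where "bij_betw f {..<16} X" "f 0 = x" "\<B> = (`) f ` set ` set (grid L M)"
    "grid L M = model \<or> set ` set (grid L M) = (`) conjugation ` set ` set model"
proof -
  interpret transversal_design 4 4 X \<G> \<B>
    by (rule assms(1))
  obtain G1 where G1: "G1 \<in> \<G>" "x \<in> G1"
    using assms(2) groups_partition by (auto simp: partition_on_def)
  have "finite \<G>"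
    using finite_elements[OF finite_points groups_partition] .
  then have "card (\<G> - {G1}) = 3"
    using G1(1) card_groups by simp
  then obtain G2 G3 G4 where rest: "\<G> - {G1} = {G2, G3, G4}" and ne': "G2 \<noteq> G3" "G2 \<noteq> G4" "G3 \<noteq> G4"
    by (auto simp only: card_3_iff)
  have groups: "\<G> = {G1, G2, G3, G4}"
    using rest G1(1) by blast
  have G: "G1 \<in> \<G>" "G2 \<in> \<G>" "G3 \<in> \<G>" "G4 \<in> \<G>"
    unfolding groups by auto
  have ne: "G1 \<noteq> G2" "G1 \<noteq> G3" "G1 \<noteq> G4" "G2 \<noteq> G3" "G2 \<noteq> G4" "G3 \<noteq> G4"
    using rest ne' by auto
  obtain b :: "nat \<Rightarrow> 'a" where b: "bij_betw b {..<4} G2"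
    using ex_bij_betw_nat_finite[OF finite_group[OF G(2)]] card_group[OF G(2)]
    by (auto simp: lessThan_atLeast0)
  define c where "c j = meet (line x (b j)) G3" for j
  define d where "d j = meet (line x (b j)) G4" for j
  have c: "bij_betw c {..<4} G3"
    unfolding c_def using perspective[OF G(2,3,1) ne(1,2) G1(2) b] .
  have d: "bij_betw d {..<4} G4"
    unfolding d_def using perspective[OF G(2,4,1) ne(1,3) G1(2) b] .
  have b0: "b 0 \<in> G2"
    using b by (auto simp: bij_betw_def)
  text \<open>This choice of \<open>a\<close> makes the first column of \<open>L\<close> the identity, and \<open>c\<close>, \<open>d\<close> do so for the first
    rows of \<open>L\<close> and \<open>M\<close>; moreover \<open>a 0 = x\<close>.\<close>
  define a where "a i = meet (line (b 0) (c i)) G1" for i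
  have a: "bij_betw a {..<4} G1"
    unfolding a_def using perspective[OF G(3,1,2) ne(4) ne(1)[symmetric] b0 c] .
  have mem: "a i \<in> G1" "b i \<in> G2" "c i \<in> G3" "d i \<in> G4" if "i < 4" for i
    using that a b c d by (auto simp: bij_betw_def)
  define T where "T i j = line (a i) (b j)" for i j
  have T: "T i j \<in> \<B>" "a i \<in> T i j" "b j \<in> T i j" if "i < 4" "j < 4" for i j
    unfolding T_def using line[OF G(1,2) ne(1) mem(1,2)] that by auto
  have TI: "T i j = B" if "B \<in> \<B>" "a i \<in> B" "b j \<in> B" "i < 4" "j < 4" for B i j
    unfolding T_def using line_eq[OF G(1,2) ne(1) mem(1,2)] that by blast
  define L where "L i j = inv_into {..<4} c (meet (T i j) G3)" for i j
  define M where "M i j = inv_into {..<4} d (meet (T i j) G4)" for i j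
  have L: "L i j < 4" "c (L i j) \<in> T i j" if "i < 4" "j < 4" for i j
  proof -
    have m: "meet (T i j) G3 \<in> c ` {..<4}" "meet (T i j) G3 \<in> T i j"
      using meet[OF T(1)[OF that] G(3)] c by (auto simp: bij_betw_def)
    then show "L i j < 4" "c (L i j) \<in> T i j"
      unfolding L_def using inv_into_into[OF m(1)] f_inv_into_f[OF m(1)] by auto
  qed
  have M: "M i j < 4" "d (M i j) \<in> T i j" if "i < 4" "j < 4" for i j
  proof -
    have m: "meet (T i j) G4 \<in> d ` {..<4}" "meet (T i j) G4 \<in> T i j"
      using meet[OF T(1)[OF that] G(4)] d by (auto simp: bij_betw_def)
    then show "M i j < 4" "d (M i j) \<in> T i j"
      unfolding M_def using inv_into_into[OF m(1)] f_inv_into_f[OF m(1)] by auto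
  qed
  have aI: "i = i'" if "a i \<in> B" "a i' \<in> B" "B \<in> \<B>" "i < 4" "i' < 4" for B i i'
    using block_transversal[OF that(3) G(1) that(1,2)] mem(1) that(4,5) a
    by (auto simp: bij_betw_def inj_on_def)
  have bI: "i = i'" if "b i \<in> B" "b i' \<in> B" "B \<in> \<B>" "i < 4" "i' < 4" for B i i'
    using block_transversal[OF that(3) G(2) that(1,2)] mem(2) that(4,5) b
    by (auto simp: bij_betw_def inj_on_def)
  have cI: "i = i'" if "c i \<in> B" "c i' \<in> B" "B \<in> \<B>" "i < 4" "i' < 4" for B i i'
    using block_transversal[OF that(3) G(3) that(1,2)] mem(3) that(4,5) c
    by (auto simp: bij_betw_def inj_on_def)
  have dI: "i = i'" if "d i \<in> B" "d i' \<in> B" "B \<in> \<B>" "i < 4" "i' < 4" for B i i'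
    using block_transversal[OF that(3) G(4) that(1,2)] mem(4) that(4,5) d
    by (auto simp: bij_betw_def inj_on_def)
  have T_inj: "i = i' \<and> j = j'" if "T i j = T i' j'" "i < 4" "j < 4" "i' < 4" "j' < 4" for i j i' j'
    using aI[OF _ _ T(1)] bI[OF _ _ T(1)] T(2,3) that by metis
  have "c 0 \<in> G3" "line x (b 0) \<in> \<B>" "x \<in> line x (b 0)" "b 0 \<in> line x (b 0)"
    using mem(3) line[OF G(1,2) ne(1) G1(2) b0] by auto
  moreover have "c 0 \<in> line x (b 0)"
    unfolding c_def using meet(1)[OF \<open>line x (b 0) \<in> \<B>\<close> G(3)] .
  \<comment> \<open>\<open>c 0\<close> lies on the block through \<open>x\<close> and
    \<open>b 0\<close>, so projecting it back from \<open>b 0\<close> returns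
    \<open>x\<close>.\<close>
  ultimately have a0: "a 0 = x"
    unfolding a_def using line_eq[OF G(2,3) ne(4) b0] meet_eq G1 by metis
  have L0: "L 0 j = j" and M0: "M 0 j = j" if j: "j < 4" for j
  proof -
    have "c j \<in> T 0 j" "d j \<in> T 0 j"
      unfolding c_def d_def T_def a0 using meet(1) line(1)[OF G(1,2) ne(1) G1(2) mem(2)[OF j]] G
      by auto
    then show "L 0 j = j" "M 0 j = j"
      using cI[OF L(2) _ T(1)] dI[OF M(2) _ T(1)] L(1) M(1) j by auto
  qed
  have Li0: "L i 0 = i" if i: "i < 4" for i
  proof -
    have l: "line (b 0) (c i) \<in> \<B>" "b 0 \<in> line (b 0) (c i)" "c i \<in> line (b 0) (c i)"
      using line[OF G(2,3) ne(4) b0 mem(3)[OF i]] .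
    moreover have "a i \<in> line (b 0) (c i)"
      unfolding a_def using meet(1)[OF l(1) G(1)] .
    ultimately have "c i \<in> T i 0"
      using TI i by simp
    then show ?thesis
      using cI[OF L(2) _ T(1)] L(1) i by auto
  qed
  have "grid L M = model \<or> set ` set (grid L M) = (`) conjugation ` set ` set model"
  \<comment> \<open>Each property says that two points of different groups determine their block:
    groups 1 and 3, 1 and 4 give the rows of \<open>L\<close> and \<open>M\<close>; 2 and 3, 2 and 4
    the columns; 3 and 4 orthogonality.\<close>
  proof (rule orthogonal_latin_squares)
    fix i j j' assume ij: "i < (4::nat)" "j < (4::nat)" "j' < (4::nat)" and eq: "L i j = L i j'"
    have "T i j = T i j'"
      using block_eq[OF G(1,3) ne(2) mem(1)[OF ij(1)] mem(3)[OF L(1)[OF ij(1,2)]] T(1,2)[OF ij(1,2)]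
          L(2)[OF ij(1,2)] T(1,2)[OF ij(1,3)]] L(2)[OF ij(1,3)] eq by simp
    then show "j = j'"
      using T_inj ij by blast
  next
    fix i j j' assume ij: "i < (4::nat)" "j < (4::nat)" "j' < (4::nat)" and eq: "M i j = M i j'"
    have "T i j = T i j'"
      using block_eq[OF G(1,4) ne(3) mem(1)[OF ij(1)] mem(4)[OF M(1)[OF ij(1,2)]] T(1,2)[OF ij(1,2)]
          M(2)[OF ij(1,2)] T(1,2)[OF ij(1,3)]] M(2)[OF ij(1,3)] eq by simp
    then show "j = j'"
      using T_inj ij by blast
  next
    fix i i' j assume ij: "i < (4::nat)" "i' < (4::nat)" "j < (4::nat)" and eq: "L i j = L i' j"
    have "T i j = T i' j"
      using block_eq[OF G(2,3) ne(4) mem(2)[OF ij(3)] mem(3)[OF L(1)[OF ij(1,3)]] T(1,3)[OF ij(1,3)]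
          L(2)[OF ij(1,3)] T(1,3)[OF ij(2,3)]] L(2)[OF ij(2,3)] eq by simp
    then show "i = i'"
      using T_inj ij by blast
  next
    fix i i' j assume ij: "i < (4::nat)" "i' < (4::nat)" "j < (4::nat)" and eq: "M i j = M i' j"
    have "T i j = T i' j"
      using block_eq[OF G(2,4) ne(5) mem(2)[OF ij(3)] mem(4)[OF M(1)[OF ij(1,3)]] T(1,3)[OF ij(1,3)]
          M(2)[OF ij(1,3)] T(1,3)[OF ij(2,3)]] M(2)[OF ij(2,3)] eq by simp
    then show "i = i'"
      using T_inj ij by blast
  next
    fix i j i' j' assume ij: "i < (4::nat)" "j < (4::nat)" "i' < (4::nat)" "j' < (4::nat)"
      and eq: "L i j = L i' j'" "M i j = M i' j'"
    have "T i j = T i' j'"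
      using block_eq[OF G(3,4) ne(6) mem(3)[OF L(1)[OF ij(1,2)]] mem(4)[OF M(1)[OF ij(1,2)]]
          T(1)[OF ij(1,2)] L(2)[OF ij(1,2)] M(2)[OF ij(1,2)] T(1)[OF ij(3,4)]]
        L(2)[OF ij(3,4)] M(2)[OF ij(3,4)] eq by simp
    then show "i = i' \<and> j = j'"
      using T_inj ij by blast
  qed (fact L(1) M(1) L0 Li0 M0)+
  moreover define f where "f v = (if v < 4 then a v else if v < 8 then b (v - 4)
    else if v < 12 then c (v - 8) else d (v - 12))" for v
  have f: "f i = a i" "f (4 + i) = b i" "f (8 + i) = c i" "f (12 + i) = d i" if "i < 4" for i
    using that by (simp_all add: f_def)
  have X: "X = G1 \<union> G2 \<union> G3 \<union> G4"
    using groups_partition unfolding partition_on_def groups by auto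
  have image: "f ` {..<16} = X"
  proof
    show "f ` {..<16} \<subseteq> X"
      unfolding X f_def using mem by auto
    have "v \<in> f ` {..<16}" if "v \<in> X" for v
    proof -
      consider i where "i < 4" "v = a i" | i where "i < 4" "v = b i"
        | i where "i < 4" "v = c i" | i where "i < 4" "v = d i"
        using \<open>v \<in> X\<close> a b c d unfolding X bij_betw_def by blast
      then show ?thesis
      proof cases
        case 1
        then show ?thesis
          using f(1) by (intro image_eqI[of _ _ i]) auto
      next
        case 2
        then show ?thesis
          using f(2) by (intro image_eqI[of _ _ "4 + i"]) auto
      next
        case 3
        then show ?thesis
          using f(3) by (intro image_eqI[of _ _ "8 + i"]) auto
      next
        case 4
        then show ?thesis
          using f(4) by (intro image_eqI[of _ _ "12 + i"]) auto
      qed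
    qed
    then show "X \<subseteq> f ` {..<16}"
      by blast
  qed
  moreover have "inj_on f {..<16}"
    by (rule eq_card_imp_inj_on) (simp_all add: image card_points)
  moreover have "f 0 = x"
    using f(1)[of 0] a0 by simp
  moreover have "\<B> = (`) f ` set ` set (grid L M)"
  proof -
    have T_set: "T i j = f ` set [i, 4 + j, 8 + L i j, 12 + M i j]" if ij: "i < 4" "j < 4" for i j
    proof -
      have "T i j \<subseteq> {a i, b j, c (L i j), d (M i j)}"
      proof
        fix v assume v: "v \<in> T i j"
        then have "v \<in> G1 \<or> v \<in> G2 \<or> v \<in> G3 \<or> v \<in> G4"
          using block_subset[OF T(1)[OF ij]] unfolding X by blast
        then show "v \<in> {a i, b j, c (L i j), d (M i j)}"
          using block_transversal[OF T(1)[OF ij] G(1) v T(2)[OF ij] _ mem(1)[OF ij(1)]]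
            block_transversal[OF T(1)[OF ij] G(2) v T(3)[OF ij] _ mem(2)[OF ij(2)]]
            block_transversal[OF T(1)[OF ij] G(3) v L(2)[OF ij] _ mem(3)[OF L(1)[OF ij]]]
            block_transversal[OF T(1)[OF ij] G(4) v M(2)[OF ij] _ mem(4)[OF M(1)[OF ij]]]
          by blast
      qed
      then show ?thesis
        using T[OF ij] L[OF ij] M[OF ij] ij by (auto simp: f)
    qed
    have "\<B> = (\<lambda>(i, j). T i j) ` ({..<4} \<times> {..<4})"
    proof
      show "(\<lambda>(i, j). T i j) ` ({..<4} \<times> {..<4}) \<subseteq> \<B>"
        using T(1) by auto
      show "\<B> \<subseteq> (\<lambda>(i, j). T i j) ` ({..<4} \<times> {..<4})"
      proof
        fix B assume B: "B \<in> \<B>"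
        obtain i where i: "i < 4" "a i \<in> B"
          using block_meets_group[OF B G(1)] a unfolding bij_betw_def by blast
        obtain j where j: "j < 4" "b j \<in> B"
          using block_meets_group[OF B G(2)] b unfolding bij_betw_def by blast
        have "T i j = B"
          using TI B i j by blast
        then show "B \<in> (\<lambda>(i, j). T i j) ` ({..<4} \<times> {..<4})"
          using i j by auto
      qed
    qed
    also have "\<dots> = (\<lambda>(i, j). f ` set [i, 4 + j, 8 + L i j, 12 + M i j]) ` ({..<4} \<times> {..<4})"
      using T_set by (intro image_cong) auto
    also have "\<dots> = (`) f ` set ` set (grid L M)"
      unfolding set_grid image_image by (intro image_cong) auto
    finally show ?thesis .
  qed
  ultimately show thesis
    by (intro that) (auto simp: bij_betw_def)
qed

lemma model_coordinates:
  fixes X :: "'a set"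
  assumes "transversal_design 4 4 X \<G> \<B>" "x \<in> X"
  obtains f where "bij_betw f {..<16} X" "f 0 = x" "\<B> = (`) f ` set ` set model"
proof -
  obtain f L M where f: "bij_betw f {..<16} X" "f 0 = x" "\<B> = (`) f ` set ` set (grid L M)"
    and "grid L M = model \<or> set ` set (grid L M) = (`) conjugation ` set ` set model"
    using coordinates[OF assms] .
  then consider "grid L M = model" | "set ` set (grid L M) = (`) conjugation ` set ` set model"
    by blast
  then show thesis
  proof cases
    case 1
    then show thesis
      using that f by simp
  next
    case 2
    \<comment> \<open>Relabelling absorbs the second case; as \<open>conjugation\<close> fixes 0,
      the point \<open>x\<close> keeps its label.\<close>
    have "\<B> = (`) (f \<circ> conjugation) ` set ` set model"
      unfolding f(3) 2 by (simp add: image_image image_comp)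
    moreover have "bij_betw (f \<circ> conjugation) {..<16} X"
      using bij_betw_trans[OF bij_betw_conjugation f(1)] .
    moreover have "(f \<circ> conjugation) 0 = x"
      using f(2) by (simp add: conjugation_def)
    ultimately show thesis
      using that by blast
  qed
qed

lemma breaker_safe_design:
  assumes "transversal_design 4 4 X \<G> \<B>"
  shows "breaker_safe X \<B>"
proof (rule breaker_safeI)
  show "{} \<notin> \<B>"
    using transversal_design.card_block[OF assms] by force
  show "\<forall>p\<in>X. \<exists>q\<in>X - {p}. breaker_safe (X - {p, q}) (residual \<B> {p} {q})"
  proof
    fix p assume "p \<in> X"
    \<comment> \<open>The labelling is chosen only after Maker's opening \<open>p\<close>, so that
      \<open>p\<close> receives the label 0.\<close>
    then obtain f where f: "bij_betw f {..<16} X" "f 0 = p" "\<B> = (`) f ` set ` set model"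
      using model_coordinates[OF assms] by blast
    have inj: "inj_on f {..<16}" and X: "f ` {..<16} = X"
      using f(1) by (auto simp: bij_betw_def)
    obtain q where q: "q \<in> {..<16} - {0}"
      and safe: "breaker_safe ({..<16} - {0, q}) (residual (set ` set model) {0} {q})"
      using model_answer by blast
    have sub: "\<Union> (set ` set model) \<subseteq> {..<16}"
      by (simp add: model_def)
    have "breaker_safe (f ` ({..<16} - {0, q})) ((`) f ` residual (set ` set model) {0} {q})"
      using sub by (intro breaker_safe_image[OF safe inj]) (auto simp: residual_def)
    moreover have "f ` ({..<16} - {0, q}) = X - {p, f q}"
      using inj_on_image_set_diff[OF inj, of "{..<16}" "{0, q}"] q X f(2) by auto
    moreover have "(`) f ` residual (set ` set model) {0} {q} = residual \<B> {p} {f q}"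
      using residual_image[OF inj sub, of "{0}" "{q}"] q f(2,3) by auto
    moreover have "f q \<in> X - {p}"
      using q X inj_on_eq_iff[OF inj, of q 0] f(2) by auto
    ultimately show "\<exists>q\<in>X - {p}. breaker_safe (X - {p, q}) (residual \<B> {p} {q})"
      by auto
  qed
qed

theorem theorem2p9:
  fixes X :: "'a set" and \<G> \<B> :: "'a set set"
  assumes "transversal_design 4 4 X \<G> \<B>"
  shows "breaker_can_win X \<B>"
  using breaker_can_win_if_safe[OF breaker_safe_design[OF assms]] .

end
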